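(* Let $F$ be a field of characteristic not $2$ and let $R$ be a unital commutative associative $F$-algebra which is a unique factorization domain. If $H\in\mathfrak{sl}_2(R)$ satisfies $H^2=I$, where $I$ is the $2\times 2$ identity matrix, then there is an element $P\in GL_2(R)$ such that $$P^{-1}HP=\begin{pmatrix}1&0\\0&-1\end{pmatrix}.$$
   Context: $\mathfrak{sl}_2(R)$ denotes the set of $2\times 2$ matrices $\begin{pmatrix}a&b\\c&-a\end{pmatrix}$ with $a,b,c\in R$. $GL_2(R)$ is the group of $2\times 2$ matrices over $R$ whose determinant is a unit of $R$. *)

theory Defs
  imports "HOL-Analysis.Analysis" "Berlekamp_Zassenhaus.Unique_Factorization"
begin

text \<open>
  Compatibility with multiplication in the second argument follows by commutativity.
\<close>

locale comm_field_algebra = vector_space scale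
  for scale :: "'f::field \<Rightarrow> 'r::comm_ring_1 \<Rightarrow> 'r" +
  assumes scale_mult_left: "scale k (x * y) = scale k x * y"

definition sl2 :: "('r::comm_ring_1 ^ 2 ^ 2) set" where
  "sl2 = {vector [vector [a, b], vector [c, - a]] | a b c. True}"

definition GL2 :: "('r::comm_ring_1 ^ 2 ^ 2) set" where
  "GL2 = {P. det P dvd 1}"

text \<open>
  The constant \<^const>\<open>matrix_inv\<close> is defined by a choice operator; on \<open>GL2\<close> it really
  is the two-sided inverse, over any commutative ring.
\<close>

lemma GL2_matrix_inv:
  fixes P :: "'r::comm_ring_1 ^ 2 ^ 2"
  assumes "P \<in> GL2"
  shows "P ** matrix_inv P = mat 1 \<and> matrix_inv P ** P = mat 1"
proof -
  from assms have "det P dvd 1" by (simp add: GL2_def)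
  then obtain u where "1 = det P * u" by (rule dvdE)
  then have u: "P$1$1 * P$2$2 * u - P$1$2 * P$2$1 * u = 1"
    unfolding det_2 left_diff_distrib by (rule sym)
  define Q :: "'r ^ 2 ^ 2" where
    "Q = vector [vector [P$2$2 * u, - (P$1$2 * u)], vector [- (P$2$1 * u), P$1$1 * u]]"
  have Q: "Q$1$1 = P$2$2 * u" "Q$1$2 = - (P$1$2 * u)" "Q$2$1 = - (P$2$1 * u)" "Q$2$2 = P$1$1 * u"
    by (simp_all add: Q_def)
  have "P ** Q = mat 1" "Q ** P = mat 1"
    using u by (simp_all add: Q vec_eq_iff matrix_matrix_mult_def mat_def sum_2 forall_2 mult_ac)
  then have "P ** Q = mat 1 \<and> Q ** P = mat 1" by (rule conjI)
  from someI[where P = "\<lambda>A'. P ** A' = mat 1 \<and> A' ** P = mat 1", OF this]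
  show ?thesis unfolding matrix_inv_def .
qed

end

theory Submission
  imports Defs
begin

text \<open>
  Since \<open>2\<close> is invertible in \<open>R\<close>, the matrix \<open>E = (I + H) / 2\<close> is defined over \<open>R\<close>; it is the
  idempotent projecting onto the \<open>1\<close>-eigenspace of \<open>H\<close>, it has trace \<open>1\<close>, and, because
  \<open>H\<^sup>2 = I\<close>, determinant \<open>0\<close>. Over the fraction field \<open>E\<close> has rank one, so it is a column times a
  row; the only question is whether column and row can be chosen with entries in \<open>R\<close>.

  This is where unique factorization enters. Writing \<open>E\<close> with rows \<open>(u, b)\<close> and \<open>(c, v)\<close>, the
  vanishing determinant says \<open>u v = b c\<close>, and in a factorial ring two factorizations of one
  element have a common refinement: \<open>u = x y\<close>, \<open>b = x z\<close>, \<open>c = w y\<close>, \<open>v = w z\<close>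
  (lemma \<open>ufd_four_number\<close>). Thus \<open>E\<close> is the column \<open>(x, w)\<close> times the row \<open>(y, z)\<close>, and trace
  \<open>1\<close> says that the row applied to the column gives \<open>1\<close>. Hence \<open>(x, w)\<close> is fixed by \<open>E\<close>, the
  vector \<open>(- z, y)\<close> is killed by \<open>E\<close>, and the matrix with these two columns has determinant
  \<open>x y + z w = 1\<close>. It therefore lies in \<open>GL\<^sub>2(R)\<close> and diagonalizes \<open>H = 2 E - I\<close>.
\<close>

text \<open>
  A product of primes dividing \<open>b * c\<close> is split prime by prime: each prime divides \<open>b\<close> or \<open>c\<close> and is
  cancelled there. Both \<open>b\<close> and \<open>c\<close> shrink along the way, so the induction runs over all pairs.
\<close>

lemma prod_mset_primes_dvd_mult_split:
  fixes b c :: "'a::idom"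
  assumes "\<And>p. p \<in># F \<Longrightarrow> prime_elem p" and "prod_mset F dvd b * c"
  shows "\<exists>x y. prod_mset F = x * y \<and> x dvd b \<and> y dvd c"
  using assms
proof (induction F arbitrary: b c)
  case empty
  show ?case by (intro exI[of _ 1]) simp
next
  case (add p F)
  have p: "prime_elem p" using add.prems(1) by simp
  have F: "\<And>q. q \<in># F \<Longrightarrow> prime_elem q" using add.prems(1) by simp
  have p0: "p \<noteq> 0" using p by auto
  have dvd: "p * prod_mset F dvd b * c" using add.prems(2) by (simp only: prod_mset.add_mset)
  then have "p dvd b * c" by (rule dvd_mult_left)
  from prime_elem_dvd_multD[OF p this] consider "p dvd b" | "p dvd c" by (rule disjE)
  then show ?case
  proof cases
    case 1
    then obtain b' where b: "b = p * b'" by (rule dvdE)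
    have "prod_mset F dvd b' * c" using dvd p0 by (simp add: b mult.assoc)
    from add.IH[OF F this] obtain x y where "prod_mset F = x * y" "x dvd b'" "y dvd c" by blast
    then show ?thesis by (intro exI[of _ "p * x"] exI[of _ y]) (simp add: b mult.assoc)
  next
    case 2
    then obtain c' where c: "c = p * c'" by (rule dvdE)
    have "prod_mset F dvd b * c'" using dvd p0 by (simp add: c mult.left_commute)
    from add.IH[OF F this] obtain x y where "prod_mset F = x * y" "x dvd b" "y dvd c'" by blast
    then show ?thesis by (intro exI[of _ x] exI[of _ "p * y"]) (simp add: c mult.left_commute)
  qed
qed

lemma ufd_dvd_mult_split:
  fixes a b c :: "'a::ufd"
  assumes "a \<noteq> 0" and "a dvd b * c"
  shows "\<exists>x y. a = x * y \<and> x dvd b \<and> y dvd c"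
proof (cases "a dvd 1")
  case True
  then have "a dvd b" by (rule dvd_trans) simp
  then show ?thesis by (intro exI[of _ a] exI[of _ 1]) simp
next
  case False
  with \<open>a \<noteq> 0\<close> obtain F where F: "mset_factors F a" using mset_factors_exist by blast
  then have a: "a = prod_mset F" and primes: "\<And>p. p \<in># F \<Longrightarrow> prime_elem p"
    by (simp_all add: mset_factors_def)
  show ?thesis
    using prod_mset_primes_dvd_mult_split[of F b c] primes assms(2) unfolding a by blast
qed

text \<open>
  The factors \<open>x\<close> and \<open>y\<close> of \<open>u\<close> that go into \<open>b\<close> and \<open>c\<close> determine the two remaining ones by
  cancelling \<open>u\<close>. When \<open>u = 0\<close>, cancellation is unavailable, but then \<open>b\<close> or \<open>c\<close> vanishes and
  the refinement can be written down.
\<close>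

lemma ufd_four_number:
  fixes u v b c :: "'a::ufd"
  assumes eq: "u * v = b * c"
  obtains x y z w where "u = x * y" "b = x * z" "c = w * y" "v = w * z"
proof (cases "u = 0")
  case True
  with eq consider "b = 0" | "c = 0" by auto
  then show thesis
  proof cases
    case 1
    with True show thesis by (intro that[of 0 c v 1]) simp_all
  next
    case 2
    with True show thesis by (intro that[of b 0 1 v]) simp_all
  qed
next
  case False
  have "u dvd b * c" by (subst eq[symmetric]) simp
  with False obtain x y where u: "u = x * y" and "x dvd b" "y dvd c"
    using ufd_dvd_mult_split by blast
  then obtain z w where b: "b = x * z" and c: "c = y * w" by (elim dvdE)
  have "u * v = u * (w * z)" by (simp add: eq) (simp add: u b c mult_ac)
  with False have "v = w * z" by simp
  with u b c show thesis by (intro that[of x y z w]) (simp_all add: mult.commute)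
qed

lemma two_invertible_in_algebra:
  fixes scale :: "'f::field \<Rightarrow> 'r::comm_ring_1 \<Rightarrow> 'r"
  assumes "vector_space scale" and "CHAR('f) \<noteq> 2"
  obtains h :: 'r where "2 * h = 1"
proof -
  interpret vector_space scale by fact
  have "(2::'f) \<noteq> 0"
  proof
    assume "(2::'f) = 0"
    then have "of_nat 2 = (0::'f)" by simp
    then have "CHAR('f) dvd 2" by (simp only: of_nat_eq_0_iff_char_dvd)
    then have "CHAR('f) = 1 \<or> CHAR('f) = 2" using two_is_prime_nat prime_nat_iff by blast
    with assms(2) show False using CHAR_not_1 by auto
  qed
  then have halves: "(1/2 + 1/2 :: 'f) = 1" by (simp add: divide_simps)
  have "2 * scale (1/2) (1::'r) = scale (1/2) 1 + scale (1/2) 1" by (rule mult_2)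
  also have "\<dots> = scale (1/2 + 1/2) 1" by (rule scale_left_distrib[symmetric])
  also have "\<dots> = 1" unfolding halves by (rule scale_one)
  finally show thesis by (rule that)
qed

theorem theorem3:
  fixes scale :: "'f::field \<Rightarrow> 'r::ufd \<Rightarrow> 'r"
    and H :: "'r ^ 2 ^ 2"
  assumes "CHAR('f) \<noteq> 2"
    and "comm_field_algebra scale"
    and "H \<in> sl2"
    and "H ** H = mat 1"
  shows "\<exists>P \<in> GL2. matrix_inv P ** H ** P = vector [vector [1, 0], vector [0, - 1]]"
proof -
  have "vector_space scale" using assms(2) by (simp add: comm_field_algebra_def)
  then obtain h :: 'r where h: "2 * h = 1" using two_invertible_in_algebra assms(1) by blast
  obtain a b c where H: "H = vector [vector [a, b], vector [c, - a]]"
    using assms(3) by (auto simp: sl2_def)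
  have "(H ** H) $ 1 $ 1 = 1" by (simp add: assms(4) mat_def)
  then have abc: "a * a + b * c = 1"
    by (simp add: H matrix_matrix_mult_def sum_2)

  \<comment> \<open>The entries of the projection \<open>E = (I + H) / 2\<close>, with \<open>h\<close> in the role of \<open>1 / 2\<close>.\<close>
  have "(h * (1 + a)) * (h * (1 - a)) = (h * b) * (h * c)"
    using abc by algebra
  then obtain x y z w
    where u: "h * (1 + a) = x * y" and b': "h * b = x * z"
      and c': "h * c = w * y" and v: "h * (1 - a) = w * z"
    by (rule ufd_four_number)

  have trace: "x * y + w * z = 1" using u v h by algebra
  have a: "a = x * y - w * z" using u v h by algebra
  have b: "b = 2 * (x * z)" using b' h by algebra
  have c: "c = 2 * (w * y)" using c' h by algebra

  define P :: "'r ^ 2 ^ 2" where "P = vector [vector [x, - z], vector [w, y]]"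
  define D :: "'r ^ 2 ^ 2" where "D = vector [vector [1, 0], vector [0, - 1]]"
  have "det P = 1" using trace by (simp add: P_def det_2 mult.commute)
  then have P: "P \<in> GL2" by (simp add: GL2_def)
  have "a * x + b * w = x" "b * y - a * z = z" "c * x - a * w = w" "- (a * y) - c * z = - y"
    using trace unfolding a b c by algebra+
  then have "H ** P = P ** D"
    by (simp add: H P_def D_def matrix_matrix_mult_def vec_eq_iff sum_2 forall_2)
  then have "matrix_inv P ** H ** P = matrix_inv P ** P ** D"
    by (simp add: matrix_mul_assoc[symmetric])
  also have "\<dots> = D" using GL2_matrix_inv[OF P] by simp
  finally show ?thesis using P unfolding D_def by blast
qed

end
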